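(* For all $a\in\{0,\dots,r-1\}$ and $\xi\in\boldsymbol\mu_r$, the function $\tilde I_{a,\xi}(x,q^{-1})$ is a solution of the $q$-difference equation $$\left[\prod_{k=1}^r\left(1-q^{rx\partial_x-k}\right)+x(-1)^{r+N}q^{\frac{r(r-1)}2+(r^2-N-1)x\partial_x}\left(1-q^{x\partial_x}\right)^{N+1}\right]I=0 .$$
   Context: Fix integers $r\ge1$, $N\ge0$. Let $$I_{\mathrm{FJRW}}(x,q)=(1-q)\sum_{\xi\in\boldsymbol\mu_r}\sum_{n\ge0}\frac{\prod_{0\le k<\lfloor n/r\rfloor}\left(1-\xi q^{\{n/r\}+\frac1r+k}\right)^{N+1}}{\prod_{k=1}^n(1-q^k)}x^n\phi_{n+1,\xi},$$ where $\phi_{a,\xi}$ ($a\in\mathbb Z/r\mathbb Z$, $\xi\in\boldsymbol\mu_r$) are basis vectors of an $r^2$-dimensional space (this is the K-theoretic FJRW $I$-function of $\sum_{i=0}^NX_i^r$ with the equivariant parameter $s$ set to $1$). Expand $$I_{\mathrm{FJRW}}(x,q)=\sum_{a=0}^{r-1}\sum_{\xi\in\boldsymbol\mu_r}x^aI_{a,\xi}(x,q)\phi_{a+1,\xi},$$ so that $I_{a,\xi}(x,q)$ is a power series in $x^r$, and $$I_{a,\xi}(x^{1/r},q^{-1})=(1-q^{-1})\sum_{d\ge0}\frac{\prod_{0\le k<d}\left(1-\xi q^{-\frac{a+1}r-k}\right)^{N+1}}{\prod_{k=1}^{rd+a}(1-q^{-k})}x^d .$$ Define $$\tilde I_{a,\xi}(x,q^{-1}):=e_{q,\,q^{\frac{a+1}r}\xi^{-1}}(x)\;I_{a,\xi}(x^{1/r},q^{-1}),$$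 where $e_{q,\lambda}(x)$ is the $q$-character, satisfying $q^{x\partial_x}e_{q,\lambda}=\lambda e_{q,\lambda}$. Here $q^{x\partial_x}$ is the $q$-shift operator $(q^{x\partial_x}f)(x)=f(qx)$, $q^{bx\partial_x+c}=q^c(q^{x\partial_x})^b$ for integers $b,c$, products of operators act from right to left, and $x$ acts by multiplication. The parameter $q$ is generic (a formal variable, or a nonzero complex number which is not a root of unity) with a fixed choice of $q^{1/r}$; series in $x$ are formal. *)

theory Defs
  imports
    "HOL-Computational_Algebra.Computational_Algebra"
    "HOL-Library.Function_Algebras"
begin

text \<open>
  Coefficients lie in a field \<open>'a\<close> of characteristic 0.  Taking the complex numbers, or a field of
  rational functions in \<open>q\<^sup>1\<^sup>/\<^sup>r\<close> over them, covers both readings of ``generic \<open>q\<close>''.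
  Throughout, \<open>p\<close> is the chosen \<open>r\<close>-th root of \<open>q\<close>, so that \<open>q = p ^ r\<close> and
  \<open>q\<^sup>m\<^sup>/\<^sup>r\<close> is \<open>p ^ m\<close>.  Replacing \<open>q\<close> by its inverse means replacing \<open>p\<close> by its inverse.
\<close>

section \<open>The I-function\<close>

definition mu :: "nat \<Rightarrow> 'a::field set" where
  "mu r = {\<xi>. \<xi> ^ r = 1}"

text \<open>
  A vector is given by its coordinates, indexed by \<open>(c, \<eta>)\<close> with \<open>c < r\<close> and \<open>\<eta> \<in> mu r\<close>; the
  first index of a basis vector is read modulo \<open>r\<close>.
\<close>

definition phi :: "nat \<Rightarrow> nat \<Rightarrow> 'a::field \<Rightarrow> nat \<times> 'a \<Rightarrow> 'a" where
  "phi r b \<xi> = (\<lambda>(c, \<eta>). if c = b mod r \<and> \<eta> = \<xi> then 1 else 0)"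

text \<open>
  A vector-valued power series in \<open>x\<close> is given by its coordinates, which are power series.
  The exponent \<open>n mod r + 1 + r * k\<close> of \<open>p\<close> is \<open>r\<close> times \<open>{n/r} + 1/r + k\<close>.
\<close>

definition I_FJRW :: "nat \<Rightarrow> nat \<Rightarrow> 'a::field \<Rightarrow> nat \<times> 'a \<Rightarrow> 'a fps" where
  "I_FJRW r N p = (\<lambda>j. Abs_fps (\<lambda>n. (1 - p ^ r) *
     (\<Sum>\<xi>\<in>mu r.
        (\<Prod>k<n div r. (1 - \<xi> * p ^ (n mod r + 1 + r * k)) ^ (N + 1)) /
        (\<Prod>k=1..n. 1 - (p ^ r) ^ k) * phi r (n + 1) \<xi> j)))"

text \<open>The component along \<open>x\<^sup>a \<phi>\<^bsub>a+1,\<xi>\<^esub>\<close>; see \<open>I_FJRW_expansion\<close> below.\<close>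

definition I_comp :: "nat \<Rightarrow> nat \<Rightarrow> 'a::field \<Rightarrow> nat \<Rightarrow> 'a \<Rightarrow> 'a fps" where
  "I_comp r N p a \<xi> = fps_shift a (I_FJRW r N p ((a + 1) mod r, \<xi>))"

text \<open>The substitution \<open>x \<mapsto> x\<^sup>1\<^sup>/\<^sup>r\<close>, meaningful for power series in \<open>x\<^sup>r\<close>.\<close>

definition subst_root :: "nat \<Rightarrow> 'a fps \<Rightarrow> 'a::zero fps" where
  "subst_root r f = Abs_fps (\<lambda>d. fps_nth f (r * d))"

lemma finite_mu: "r > 0 \<Longrightarrow> finite (mu r :: 'a::field set)"
proof -
  assume r: "r > 0"
  let ?P = "monom 1 r - 1 :: 'a poly"
  have "coeff ?P r = 1" using r by simp
  then have "?P \<noteq> 0" by (metis coeff_0 zero_neq_one)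
  then have "finite {z. poly ?P z = 0}" by (rule poly_roots_finite)
  then show ?thesis by (simp add: mu_def poly_monom)
qed

lemma I_FJRW_nth:
  fixes p :: "'a::field"
  assumes "r > 0" "\<xi> \<in> mu r"
  shows "fps_nth (I_FJRW r N p (c, \<xi>)) n =
    (if c = (n + 1) mod r then (1 - p ^ r) *
       ((\<Prod>k<n div r. (1 - \<xi> * p ^ (n mod r + 1 + r * k)) ^ (N + 1)) /
        (\<Prod>k=1..n. 1 - (p ^ r) ^ k)) else 0)"
proof -
  have S: "(\<Sum>\<zeta>\<in>mu r. g \<zeta> * phi r (n + 1) \<zeta> (c, \<xi>)) = (if c = (n + 1) mod r then g \<xi> else 0)" for g
  proof -
    have S: "(\<Sum>\<zeta>\<in>mu r. g \<zeta> * phi r (n + 1) \<zeta> (c, \<xi>)) =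
        (\<Sum>\<zeta>\<in>mu r. if \<xi> = \<zeta> then (if c = (n + 1) mod r then g \<zeta> else 0) else 0)"
      by (intro sum.cong refl) (simp add: phi_def)
    then show ?thesis using assms finite_mu[OF assms(1), where 'a='a] by simp
  qed
  show ?thesis unfolding I_FJRW_def fps_nth_Abs_fps S by (simp only: mult_zero_right split: if_split) blast
qed

lemma mod_Suc_eq_iff:
  assumes "a < (r::nat)"
  shows "(a + 1) mod r = (n + 1) mod r \<longleftrightarrow> n mod r = a"
  using assms nat_mod_eq_iff[of a 1 r] 
  by (metis Suc_eq_plus1 Suc_inject mod_Suc mod_less nat.distinct(1))

lemma I_comp_power_series_in_x_r:
  fixes p :: "'a::field"
  assumes "a < r" "\<xi> \<in> mu r"
  shows "subst_root r (I_comp r N p a \<xi>) oo fps_X ^ r = I_comp r N p a \<xi>"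
proof (rule fps_ext)
  fix n
  have r: "r > 0" using assms by simp
  have z: "fps_nth (I_comp r N p a \<xi>) n = 0" if "\<not> r dvd n"
  proof -
    have "(n + a) mod r \<noteq> a"
    proof
      assume "(n + a) mod r = a"
      then have "(n + a) mod r = (0 + a) mod r" using assms by simp
      then have "r dvd (n + a) - (0 + a)"
        using mod_eq_dvd_iff_nat[of "0 + a" "n + a" r] by simp
      with that show False by simp
    qed
    then have "(a + 1) mod r \<noteq> (n + a + 1) mod r"
      using mod_Suc_eq_iff[OF assms(1), of "n + a"] by blast
    then show ?thesis
      by (simp only: I_comp_def fps_shift_nth I_FJRW_nth[OF r assms(2)] if_False)
  qed
  show "fps_nth (subst_root r (I_comp r N p a \<xi>) oo fps_X ^ r) n = fps_nth (I_comp r N p a \<xi>) n"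
    using z r by (auto simp: fps_nth_compose_X_power subst_root_def)
qed

lemma I_FJRW_expansion:
  fixes p :: "'a::field"
  assumes r: "r > 0" and j: "c < r" "\<eta> \<in> mu r"
  shows "I_FJRW r N p (c, \<eta>) =
    (\<Sum>a<r. \<Sum>\<xi>\<in>mu r. fps_X ^ a * I_comp r N p a \<xi> * fps_const (phi r (a + 1) \<xi> (c, \<eta>)))"
proof (rule fps_ext)
  fix n
  define a0 where "a0 = (c + r - 1) mod r"
  have a0: "a0 < r" using r by (simp add: a0_def)
  have c0: "c = (a + 1) mod r \<longleftrightarrow> a = a0" if "a < r" for a
  proof -
    have "(a0 + 1) mod r = c" using r j by (simp add: a0_def mod_Suc_eq)
    then show ?thesis using mod_Suc_eq_iff[OF a0, of a] that by auto
  qed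
  have "(\<Sum>a<r. \<Sum>\<xi>\<in>mu r. fps_X ^ a * I_comp r N p a \<xi> * fps_const (phi r (a + 1) \<xi> (c, \<eta>)))
     = (\<Sum>a<r. \<Sum>\<xi>\<in>mu r. if \<xi> = \<eta> then (if a = a0 then fps_X ^ a * I_comp r N p a \<xi> else 0) else 0)"
    using c0 by (intro sum.cong refl) (auto simp: phi_def)
  also have "\<dots> = fps_X ^ a0 * I_comp r N p a0 \<eta>"
    using a0 j finite_mu[OF r, where 'a='a] by simp
  finally have E: "(\<Sum>a<r. \<Sum>\<xi>\<in>mu r. fps_X ^ a * I_comp r N p a \<xi> *
     fps_const (phi r (a + 1) \<xi> (c, \<eta>))) = fps_X ^ a0 * I_comp r N p a0 \<eta>" .
  have "fps_nth (I_FJRW r N p (c, \<eta>)) n = 0" if "n < a0"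
  proof -
    have "c \<noteq> (n + 1) mod r" using c0[of n] that a0 by auto
    then show ?thesis by (simp only: I_FJRW_nth[OF r j(2)] if_False)
  qed
  moreover have "c = (a0 + 1) mod r" using c0[OF a0] by simp
  ultimately show "fps_nth (I_FJRW r N p (c, \<eta>)) n = fps_nth (\<Sum>a<r. \<Sum>\<xi>\<in>mu r. fps_X ^ a *
     I_comp r N p a \<xi> * fps_const (phi r (a + 1) \<xi> (c, \<eta>))) n"
    unfolding E by (auto simp: fps_X_power_mult_nth I_comp_def)
qed

lemma subst_root_I_comp_nth:
  fixes p :: "'a::field"
  assumes "a < r" "\<xi> \<in> mu r"
  shows "fps_nth (subst_root r (I_comp r N p a \<xi>)) d =
    (1 - p ^ r) * ((\<Prod>k<d. (1 - \<xi> * p ^ (a + 1 + r * k)) ^ (N + 1)) /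
                   (\<Prod>k=1..r * d + a. 1 - (p ^ r) ^ k))"
proof -
  have r: "r > 0" using assms by simp
  have 1: "(r * d + a) mod r = a" "(r * d + a) div r = d" using assms(1) by auto
  then have "(a + 1) mod r = (r * d + a + 1) mod r"
    using mod_Suc_eq_iff[OF assms(1), of "r * d + a"] by simp
  then show ?thesis
    by (simp only: subst_root_def I_comp_def fps_nth_Abs_fps fps_shift_nth I_FJRW_nth[OF r assms(2)]
        if_True 1 simp_thms)
qed


section \<open>q-difference operators and q-characters\<close>

text \<open>
  The \<open>q\<close>-characters are not power series in \<open>x\<close>, so the equation lives in a larger ring of
  functions: a commutative ring receiving the formal power series through \<open>emb\<close>, with an
  automorphism \<open>shift\<close> (the operator \<open>q\<^bsup>x\<partial>\<^esup>\<close>) extending \<open>f(x) \<mapsto> f(qx)\<close>.  Nothing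
  about a \<open>q\<close>-character is used except its defining equation, so any such ring is allowed.
\<close>

locale q_difference_ring =
  fixes q :: "'a::field" and emb :: "'a fps \<Rightarrow> 'b::comm_ring_1" and shift :: "'b \<Rightarrow> 'b"
  assumes emb_1: "emb 1 = 1"
    and emb_add: "emb (f + g) = emb f + emb g"
    and emb_mult: "emb (f * g) = emb f * emb g"
    and shift_1: "shift 1 = 1"
    and shift_add: "shift (F + G) = shift F + shift G"
    and shift_mult: "shift (F * G) = shift F * shift G"
    and bij_shift: "bij shift"
    and shift_emb: "shift (emb f) = emb (f oo (fps_const q * fps_X))"

definition q_character ::
  "('a::field fps \<Rightarrow> 'b::comm_ring_1) \<Rightarrow> ('b \<Rightarrow> 'b) \<Rightarrow> 'a \<Rightarrow> 'b \<Rightarrow> bool" where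
  "q_character emb shift l e \<longleftrightarrow> shift e = emb (fps_const l) * e"

definition funpow_int :: "('b \<Rightarrow> 'b) \<Rightarrow> int \<Rightarrow> 'b \<Rightarrow> 'b" where
  "funpow_int T b = (if b \<ge> 0 then T ^^ nat b else inv T ^^ nat (- b))"

text \<open>The operator \<open>q\<^bsup>bx\<partial>+c\<^esup>\<close>.\<close>

definition qop ::
  "'a::field \<Rightarrow> ('a fps \<Rightarrow> 'b::comm_ring_1) \<Rightarrow> ('b \<Rightarrow> 'b) \<Rightarrow> int \<Rightarrow> int \<Rightarrow> 'b \<Rightarrow> 'b" where
  "qop q emb shift b c F = emb (fps_const (q powi c)) * funpow_int shift b F"

text \<open>The product \<open>T 1 \<circ> \<dots> \<circ> T n\<close>.\<close>

definition op_prod :: "(nat \<Rightarrow> 'b \<Rightarrow> 'b) \<Rightarrow> nat \<Rightarrow> 'b \<Rightarrow> 'b" where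
  "op_prod T n = foldr (\<circ>) (map T [1..<Suc n]) id"

definition FJRW_operator :: "nat \<Rightarrow> nat \<Rightarrow>
    'a::field \<Rightarrow> ('a fps \<Rightarrow> 'b::comm_ring_1) \<Rightarrow> ('b \<Rightarrow> 'b) \<Rightarrow> 'b \<Rightarrow> 'b" where
  "FJRW_operator r N q emb shift F =
     op_prod (\<lambda>k G. G - qop q emb shift (int r) (- int k) G) r F +
     emb fps_X * ((-1) ^ (r + N) *
       qop q emb shift (int r ^ 2 - int N - 1) (int (r * (r - 1) div 2))
         (((\<lambda>G. G - qop q emb shift 1 0 G) ^^ (N + 1)) F))"

text \<open>
  \<open>e l\<close> stands for the \<open>q\<close>-character \<open>e\<^bsub>q,l\<^esub>\<close>; here \<open>l\<close> is \<open>q\<^bsup>(a+1)/r\<^esup> \<xi>\<^sup>-\<^sup>1\<close>.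
\<close>

definition I_tilde :: "nat \<Rightarrow> nat \<Rightarrow> 'a::field \<Rightarrow> ('a fps \<Rightarrow> 'b::comm_ring_1) \<Rightarrow> ('a \<Rightarrow> 'b) \<Rightarrow>
    nat \<Rightarrow> 'a \<Rightarrow> 'b" where
  "I_tilde r N p emb e a \<xi> =
     e (p ^ (a + 1) * inverse \<xi>) * emb (subst_root r (I_comp r N (inverse p) a \<xi>))"

text \<open>
  A ring with nonzero (indeed invertible) \<open>q\<close>-characters for all \<open>l \<noteq> 0\<close>: the functions on the
  set of powers of \<open>q\<close> (indexed by their exponents) with power series values.
\<close>

lemma fps_compose_scale_inverse:
  fixes f :: "'a::field fps"
  assumes "b * c = 1"
  shows "(f oo (fps_const b * fps_X)) oo (fps_const c * fps_X) = f"
proof -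
  have "c ^ n * b ^ n = 1" for n
    using assms by (metis mult.commute power_mult_distrib power_one)
  then show ?thesis
    by (simp add: fps_compose_linear fps_eq_iff flip: mult.assoc)
qed

lemma q_difference_ring_example:
  fixes q :: "'a::field"
  assumes "q \<noteq> 0"
  defines "emb \<equiv> (\<lambda>f (n::int). f)"
    and "shift \<equiv> (\<lambda>F (n::int). F (n + 1) oo (fps_const q * fps_X))"
    and "e \<equiv> (\<lambda>l (n::int). fps_const (l powi n))"
  shows "q_difference_ring q emb shift"
    and "l \<noteq> 0 \<Longrightarrow> q_character emb shift l (e l) \<and> e l * e (inverse l) = 1"
proof -
  let ?back = "\<lambda>F (n::int). F (n - 1) oo (fps_const (inverse q) * fps_X)"
  have "bij shift"
    by (rule o_bij[where g = ?back])
      (auto simp: fun_eq_iff shift_def fps_compose_scale_inverse assms(1))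
  then show "q_difference_ring q emb shift"
    by unfold_locales
      (auto simp: emb_def shift_def fun_eq_iff fps_compose_add_distrib fps_compose_mult_distrib)
  show "q_character emb shift l (e l) \<and> e l * e (inverse l) = 1" if "l \<noteq> 0"
    using that by (auto simp: q_character_def emb_def shift_def e_def fun_eq_iff
        power_int_add power_int_inverse mult.commute)
qed

end

theory Submission
  imports Defs
begin

text \<open>
  On the product of a \<open>q\<close>-character \<open>e\<^bsub>q,l\<^esub>\<close> and a power series, \<open>q\<^bsup>x\<partial>\<^esup>\<close> acts on the
  coefficient of \<open>x\<^sup>n\<close> as multiplication by \<open>l q\<^sup>n\<close>, so every operator in the equation is diagonal
  up to the factor \<open>x\<close>, and the equation is a two-term recurrence for the coefficients.  For
  \<open>l = q\<^bsup>(a+1)/r\<^esup> \<xi>\<^bsup>-1\<^esup>\<close> one has \<open>(l q\<^sup>n)\<^sup>r = q\<^bsup>a+1+rn\<^esup>\<close>; hence the first product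
  vanishes at \<open>n = 0\<close> and at \<open>n = d + 1\<close> it cancels, up to sign and a power of \<open>q\<close>, the
  denominators \<open>1 - q\<^bsup>-k\<^esup>\<close> that distinguish the coefficient of \<open>x\<^bsup>d+1\<^esup>\<close> from that of \<open>x\<^sup>d\<close>.
\<close>

section \<open>Diagonal operators on power series\<close>

definition fps_scale :: "(nat \<Rightarrow> 'a::semiring_0) \<Rightarrow> 'a fps \<Rightarrow> 'a fps" where
  "fps_scale m f = Abs_fps (\<lambda>n. m n * fps_nth f n)"

lemma fps_scale_nth [simp]: "fps_nth (fps_scale m f) n = m n * fps_nth f n"
  by (simp add: fps_scale_def)

lemma fps_scale_fps_scale: "fps_scale m (fps_scale m' f) = fps_scale (\<lambda>n. m n * m' n) f"
  by (simp add: fps_eq_iff mult.assoc)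

lemma fps_scale_one [simp]: "fps_scale (\<lambda>n. 1 :: 'a::semiring_1) f = f"
  by (simp add: fps_eq_iff)

lemma op_prod_0 [simp]: "op_prod T 0 = id"
  by (simp add: op_prod_def)

lemma op_prod_Suc: "op_prod T (Suc n) F = op_prod T n (T (Suc n) F)"
proof -
  \<comment> \<open>Freeing the start value of the fold allows the innermost factor, which acts
    first, to be split off.\<close>
  have "foldr (\<circ>) Ts g = foldr (\<circ>) Ts id \<circ> g" for Ts :: "('a \<Rightarrow> 'a) list" and g
    by (induction Ts) auto
  from this[of "map T [1..<Suc n]" "T (Suc n)"] show ?thesis
    by (simp add: op_prod_def)
qed

section \<open>Operators acting on a character times a power series\<close>

context q_difference_ring
begin

lemma emb_0: "emb 0 = 0"
  using emb_add[of 0 0] by simp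

lemma emb_diff: "emb (f - g) = emb f - emb g"
  using emb_add[of "f - g" g] by simp

lemma emb_minus_one_power: "emb ((-1) ^ n) = (-1) ^ n"
proof (induction n)
  case (Suc n)
  have "emb (-1) = -1"
    using emb_diff[of 0 1] by (simp add: emb_0 emb_1)
  with Suc show ?case by (simp only: power_Suc emb_mult)
qed (simp add: emb_1)

lemma shift_character_mult:
  assumes "q_character emb shift l E"
  shows "shift (E * emb f) = E * emb (fps_scale (\<lambda>n. l * q ^ n) f)"
proof -
  have "fps_scale (\<lambda>n. l * q ^ n) f = fps_const l * (f oo (fps_const q * fps_X))"
    by (simp add: fps_eq_iff fps_compose_linear mult.assoc)
  then show ?thesis
    using assms by (simp add: shift_mult shift_emb q_character_def emb_mult mult_ac)
qed

text \<open>Serves the exponent \<open>int r ^ 2 - int N - 1\<close>, which may be negative. By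
  bijectivity it suffices to apply \<open>shift\<close> to the right-hand side, where the nonzero
  eigenvalues \<open>l * q ^ n\<close> cancel.\<close>

lemma inv_shift_character_mult:
  assumes "q_character emb shift l E" "l \<noteq> 0" "q \<noteq> 0"
  shows "inv shift (E * emb f) = E * emb (fps_scale (\<lambda>n. inverse (l * q ^ n)) f)"
proof -
  have "shift (E * emb (fps_scale (\<lambda>n. inverse (l * q ^ n)) f)) = E * emb f"
    using assms(2,3) unfolding shift_character_mult[OF assms(1)] fps_scale_fps_scale
    by (simp del: inverse_mult_distrib)
  then show ?thesis
    using bij_shift by (metis bij_inv_eq_iff)
qed

lemma funpow_character_mult:
  assumes "\<And>f. T (E * emb f) = E * emb (fps_scale m f)"
  shows "(T ^^ k) (E * emb f) = E * emb (fps_scale (\<lambda>n. m n ^ k) f)"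
  by (induction k) (simp_all add: assms fps_scale_fps_scale)

lemma funpow_int_character_mult:
  assumes "q_character emb shift l E" "l \<noteq> 0" "q \<noteq> 0"
  shows "funpow_int shift b (E * emb f) = E * emb (fps_scale (\<lambda>n. (l * q ^ n) powi b) f)"
  using funpow_character_mult[OF shift_character_mult[OF assms(1)], of "nat b" f]
    funpow_character_mult[OF inv_shift_character_mult[OF assms], of "nat (- b)" f]
  by (simp add: funpow_int_def power_int_def)

lemma qop_character_mult:
  assumes "q_character emb shift l E" "l \<noteq> 0" "q \<noteq> 0"
  shows "qop q emb shift b c (E * emb f) =
    E * emb (fps_scale (\<lambda>n. q powi c * (l * q ^ n) powi b) f)"
proof -
  have "fps_scale (\<lambda>n. q powi c * (l * q ^ n) powi b) f =
      fps_const (q powi c) * fps_scale (\<lambda>n. (l * q ^ n) powi b) f"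
    by (simp add: fps_eq_iff mult.assoc)
  then show ?thesis
    by (simp add: qop_def funpow_int_character_mult[OF assms] emb_mult mult_ac)
qed

lemma diff_qop_character_mult:
  assumes "q_character emb shift l E" "l \<noteq> 0" "q \<noteq> 0"
  shows "E * emb f - qop q emb shift b c (E * emb f) =
    E * emb (fps_scale (\<lambda>n. 1 - q powi c * (l * q ^ n) powi b) f)"
proof -
  have "fps_scale (\<lambda>n. 1 - q powi c * (l * q ^ n) powi b) f =
      f - fps_scale (\<lambda>n. q powi c * (l * q ^ n) powi b) f"
    by (simp add: fps_eq_iff algebra_simps)
  then show ?thesis
    by (simp only: qop_character_mult[OF assms] emb_diff right_diff_distrib)
qed

lemma op_prod_character_mult:
  assumes "\<And>k f. T k (E * emb f) = E * emb (fps_scale (m k) f)"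
  shows "op_prod T r (E * emb f) = E * emb (fps_scale (\<lambda>n. \<Prod>k=1..r. m k n) f)"
  by (induction r arbitrary: f) (simp_all add: op_prod_Suc assms fps_scale_fps_scale)

text \<open>Every summand keeps the factor \<open>E\<close>, so the equation follows once the power
  series next to \<open>E\<close> is zero; \<open>E\<close> never has to be cancelled.\<close>

lemma FJRW_operator_character_mult:
  assumes "q_character emb shift l E" "l \<noteq> 0" "q \<noteq> 0"
  shows "FJRW_operator r N q emb shift (E * emb f) = E * emb
    (fps_scale (\<lambda>n. \<Prod>k=1..r. 1 - q powi (- int k) * (l * q ^ n) powi int r) f +
     fps_X * ((-1) ^ (r + N) * fps_scale (\<lambda>n. q powi int (r * (r - 1) div 2) *
       (l * q ^ n) powi (int r ^ 2 - int N - 1) * (1 - l * q ^ n) ^ (N + 1)) f))"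
proof -
  have "E * emb f - qop q emb shift 1 0 (E * emb f) = E * emb (fps_scale (\<lambda>n. 1 - l * q ^ n) f)"
    for f
    using diff_qop_character_mult[OF assms, of f 1 0] by simp
  note 1 = funpow_character_mult[where T = "\<lambda>G. G - qop q emb shift 1 0 G", OF this]
  note 2 = op_prod_character_mult[where T = "\<lambda>k G. G - qop q emb shift (int r) (- int k) G",
      OF diff_qop_character_mult[OF assms]]
  show ?thesis
    unfolding FJRW_operator_def 1 2 qop_character_mult[OF assms] fps_scale_fps_scale
      emb_add emb_mult emb_minus_one_power
    by (simp only: distrib_left mult.left_commute)
qed

end

section \<open>Signs and powers of \<open>q\<close> in passing from \<open>q\<close> to its
  inverse\<close>

lemma one_minus_inverse_power:
  fixes u :: "'a::field"
  assumes "u \<noteq> 0"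
  shows "(1 - inverse u) ^ n = (-1) ^ n * inverse u ^ n * (1 - u) ^ n"
proof -
  have "1 - inverse u = (-1) * inverse u * (1 - u)"
    using assms by (simp add: field_simps)
  then show ?thesis by (metis power_mult_distrib)
qed

lemma mult_pred_div_2_Suc: "Suc r * (Suc r - 1) div 2 = r * (r - 1) div 2 + r"
proof (cases r)
  case (Suc s)
  \<comment> \<open>The increment is even, so \<open>div 2\<close> is additive here.\<close>
  have "Suc r * (Suc r - 1) = r * (r - 1) + r * 2"
    by (simp add: Suc)
  then show ?thesis by simp
qed simp

text \<open>Apply \<open>1 - z = - z * (1 - inverse z)\<close> to each
  \<open>z = q ^ (m + i)\<close>; the exponents \<open>m + i\<close> sum to
  \<open>r * (m + 1) + r * (r - 1) div 2\<close>.\<close>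

lemma prod_one_minus_power_inverse:
  fixes q :: "'a::field"
  assumes "q \<noteq> 0"
  shows "(\<Prod>i=1..r. 1 - q ^ (m + i)) =
    (-1) ^ r * q ^ (r * (m + 1) + r * (r - 1) div 2) * (\<Prod>i=1..r. 1 - inverse q ^ (m + i))"
proof (induction r)
  case (Suc r)
  have E: "Suc r * (m + 1) + Suc r * (Suc r - 1) div 2 =
      (r * (m + 1) + r * (r - 1) div 2) + (m + Suc r)"
    unfolding mult_pred_div_2_Suc by simp
  have F: "1 - q ^ (m + Suc r) = (-1) * q ^ (m + Suc r) * (1 - inverse q ^ (m + Suc r))"
    using right_inverse[of "q ^ (m + Suc r)"] assms
    by (simp only: right_diff_distrib mult.assoc power_inverse) simp
  have P: "prod f {1..Suc r} = prod f {1..r} * f (Suc r)" for f :: "nat \<Rightarrow> 'a"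
    by simp
  show ?case
    unfolding P Suc.IH E power_add[of q _ "m + Suc r"] power_Suc[of "-1"]
    by (subst F) (simp only: mult_ac)
qed simp

lemma prod_rev_one_minus_powi:
  fixes q :: "'a::field"
  assumes "q \<noteq> 0"
  shows "(\<Prod>k=1..r. 1 - q powi (- int k) * q ^ (m + 1 + r)) = (\<Prod>i=1..r. 1 - q ^ (m + i))"
proof -
  \<comment> \<open>Reversing the product by \<open>k = r + 1 - i\<close> turns the exponent
    \<open>m + 1 + r - k\<close> into \<open>m + i\<close>.\<close>
  have "q powi (- int (r + 1 - i)) * q ^ (m + 1 + r) = q ^ (m + i)" if "i \<in> {1..r}" for i
  proof -
    have "m + 1 + r = (r + 1 - i) + (m + i)"
      using that by auto
    then have "q ^ (m + 1 + r) = q ^ (r + 1 - i) * q ^ (m + i)"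
      by (metis power_add)
    then show ?thesis
      unfolding power_int_minus power_int_of_nat using assms by simp
  qed
  then show ?thesis
    by (subst prod.atLeastAtMost_rev, intro prod.cong refl) (simp only:)
qed

section \<open>The coefficient recurrence and the equation\<close>

text \<open>From \<open>d\<close> to \<open>Suc d\<close> the numerator gains its factor at
  \<open>k = d\<close>, which involves the inverse of the eigenvalue \<open>l * q ^ d\<close>, and
  the denominator gains \<open>r\<close> factors, cleared to the left.\<close>

lemma I_comp_coefficient_Suc:
  fixes p q \<xi> :: "'a::field" and N :: nat
  assumes pq: "p ^ r = q" and q: "q \<noteq> 0" "\<forall>n>0. q ^ n \<noteq> 1" and a: "a < r" and xi: "\<xi> \<in> mu r"
  defines "c \<equiv> fps_nth (subst_root r (I_comp r N (inverse p) a \<xi>))"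
    and "l \<equiv> p ^ (a + 1) * inverse \<xi>"
  shows "c (Suc d) * (\<Prod>i=1..r. 1 - inverse q ^ (r * d + a + i)) =
    c d * (1 - inverse (l * q ^ d)) ^ (N + 1)"
proof -
  have c: "c d = (1 - inverse q) * ((\<Prod>k<d. (1 - \<xi> * inverse p ^ (a + 1 + r * k)) ^ (N + 1)) /
      (\<Prod>k=1..r * d + a. 1 - inverse q ^ k))" for d
    unfolding c_def subst_root_I_comp_nth[OF a xi] power_inverse pq ..
  have l: "\<xi> * inverse p ^ (a + 1 + r * d) = inverse (l * q ^ d)"
    unfolding l_def pq[symmetric] by (simp add: power_add power_mult power_inverse mult_ac)
      (simp add: mult.commute flip: power_mult)
  have S: "(\<Prod>k=1..m + n. f k) = (\<Prod>k=1..m. f k) * (\<Prod>i=1..n. f (m + i))"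
    for f :: "nat \<Rightarrow> 'a" and m n
    by (induction n) (simp_all add: mult.assoc)
  \<comment> \<open>The exponent is positive and \<open>q\<close> is not a root of unity, so the new
    denominator factors are nonzero.\<close>
  have "inverse q ^ (r * d + a + i) \<noteq> 1" if "i \<ge> 1" for i
    using q that by (simp add: power_inverse)
  then have nz: "(\<Prod>i=1..r. 1 - inverse q ^ (r * d + a + i)) \<noteq> 0"
    by auto
  have E: "r * Suc d + a = r * d + a + r"
    by simp
  show ?thesis
    using nz unfolding c E S prod.lessThan_Suc l by simp
qed

theorem theorem5p8:
  fixes p q \<xi> :: "'a::field_char_0"
    and emb :: "'a fps \<Rightarrow> 'b::comm_ring_1"
    and shift :: "'b \<Rightarrow> 'b"
    and e :: "'a \<Rightarrow> 'b"
    and r N a :: nat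
  assumes "r \<ge> 1"
    and "p ^ r = q"
    and "q \<noteq> 0"
    and "\<forall>n>0. q ^ n \<noteq> 1"
    and "q_difference_ring q emb shift"
    and "\<forall>l. l \<noteq> 0 \<longrightarrow> q_character emb shift l (e l)"
    and "a \<in> {0..r - 1}"
    and "\<xi> \<in> mu r"
  shows "FJRW_operator r N q emb shift (I_tilde r N p emb e a \<xi>) = 0"
proof -
  interpret q_difference_ring q emb shift by fact
  note q = \<open>q \<noteq> 0\<close>
  have a: "a < r" using assms by auto
  define l where "l = p ^ (a + 1) * inverse \<xi>"
  define f where "f = subst_root r (I_comp r N (inverse p) a \<xi>)"
  have xi: "\<xi> ^ r = 1" using assms(8) by (simp add: mu_def)
  have "p \<noteq> 0" "\<xi> \<noteq> 0" using q assms(1,2) xi by (auto simp: power_0_left split: if_splits)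
  then have l: "l \<noteq> 0" by (simp add: l_def)
  have "l ^ r = (p ^ r) ^ (a + 1)"
    unfolding l_def power_mult_distrib power_inverse xi
    by (simp only: inverse_1 mult_1_left mult_1_right mult.commute flip: power_mult)
  then have lr: "(l * q ^ n) ^ r = q ^ (a + 1 + r * n)" for n
    unfolding power_mult_distrib assms(2) power_add by (simp only: mult.commute flip: power_mult)
  \<comment> \<open>The coefficient of \<open>x^n\<close> in the equation: multiplication by
    \<open>fps_X\<close> shifts the second term to \<open>n - 1\<close> and removes it at
    \<open>n = 0\<close>.\<close>
  have "(\<Prod>k=1..r. 1 - q powi (- int k) * (l * q ^ n) powi int r) * fps_nth f n +
      (if n = 0 then 0 else (-1) ^ (r + N) * (q powi int (r * (r - 1) div 2) *
       (l * q ^ (n - 1)) powi (int r ^ 2 - int N - 1) * (1 - l * q ^ (n - 1)) ^ (N + 1) *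
        fps_nth f (n - 1))) = 0" for n
  proof (cases n)
    case 0
    \<comment> \<open>The factor \<open>k = a + 1\<close> vanishes because
      \<open>l ^ r = q ^ (a + 1)\<close>; it occurs in the product since
      \<open>a < r\<close>.\<close>
    have "1 - q powi (- int (a + 1)) * (l * q ^ n) powi int r = 0"
      unfolding power_int_minus power_int_of_nat lr 0 using q by (simp add: field_simps)
    then have "(\<Prod>k=1..r. 1 - q powi (- int k) * (l * q ^ n) powi int r) = 0"
      using a by (intro prod_zero bexI[of _ "a + 1"]) auto
    with 0 show ?thesis by simp
  next
    case (Suc d)
    define u where "u = l * q ^ d"
    have u: "u \<noteq> 0" using l q by (simp add: u_def)
    \<comment> \<open>The power of \<open>q\<close> released by inverting the \<open>r\<close>
      factors, with \<open>m = r * d + a\<close>.\<close>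
    define Q where "Q = q ^ (r * (r * d + a + 1) + r * (r - 1) div 2)"
    have E: "a + 1 + r * Suc d = r * d + a + 1 + r" by simp
    have "(\<Prod>k=1..r. 1 - q powi (- int k) * (l * q ^ n) powi int r) * fps_nth f n =
        (-1) ^ r * Q * (fps_nth f (Suc d) * (\<Prod>i=1..r. 1 - inverse q ^ (r * d + a + i)))"
      unfolding Suc power_int_of_nat lr E prod_rev_one_minus_powi[OF q]
        prod_one_minus_power_inverse[OF q] Q_def by (simp only: mult_ac)
    also have "\<dots> = (-1) ^ r * Q * (fps_nth f d *
        ((-1) ^ (N + 1) * inverse u ^ (N + 1) * (1 - u) ^ (N + 1)))"
      unfolding f_def I_comp_coefficient_Suc[OF assms(2) q assms(4) a assms(8)]
      unfolding l_def[symmetric] u_def[symmetric] one_minus_inverse_power[OF u] ..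
    \<comment> \<open>The signs \<open>(-1) ^ r\<close> and \<open>(-1) ^ (N + 1)\<close> combine to
      the opposite of the operator's sign, so the two terms cancel.\<close>
    finally have 1: "(\<Prod>k=1..r. 1 - q powi (- int k) * (l * q ^ n) powi int r) * fps_nth f n =
        - ((-1) ^ (r + N) * (Q * inverse u ^ (N + 1) * (1 - u) ^ (N + 1) * fps_nth f d))"
      by (simp add: power_add mult_ac)
    \<comment> \<open>Of this power, \<open>u ^ (r * r)\<close> supplies the part of
      \<open>Q\<close> missing from the operator, and the rest matches
      \<open>inverse u ^ (N + 1)\<close>.\<close>
    have "u powi (int r ^ 2 - int N - 1) = u powi (int (r * r) - int (N + 1))"
      by (simp add: power2_eq_square algebra_simps)
    also have "\<dots> = (u ^ r) ^ r * inverse u ^ (N + 1)"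
      unfolding power_int_diff[OF disjI1[OF u]] power_int_of_nat
      by (simp only: power_mult divide_inverse power_inverse)
    also have "(u ^ r) ^ r = q ^ (r * (r * d + a + 1))"
      unfolding u_def lr by (simp only: mult.commute add_ac flip: power_mult)
    finally have "q powi int (r * (r - 1) div 2) * u powi (int r ^ 2 - int N - 1) =
        Q * inverse u ^ (N + 1)"
      unfolding Q_def power_int_of_nat power_add by (simp only: mult_ac)
    then show ?thesis
      unfolding 1 by (simp add: Suc u_def)
  qed
  \<comment> \<open>Here the sign is itself a power series and must be moved out of the
    coefficient.\<close>
  moreover have "fps_nth ((-1) ^ k * g) n = (-1) ^ k * fps_nth g n" for k n and g :: "'a fps"
    by (cases "even k") simp_all
  ultimately have "fps_scale (\<lambda>n. \<Prod>k=1..r. 1 - q powi (- int k) * (l * q ^ n) powi int r) f +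
      fps_X * ((-1) ^ (r + N) * fps_scale (\<lambda>n. q powi int (r * (r - 1) div 2) *
       (l * q ^ n) powi (int r ^ 2 - int N - 1) * (1 - l * q ^ n) ^ (N + 1)) f) = 0"
    by (simp only: fps_eq_iff fps_add_nth fps_X_mult_nth fps_scale_nth fps_zero_nth simp_thms)
  then show ?thesis
    using FJRW_operator_character_mult[OF assms(6)[rule_format, OF l] l q, of r N f]
    by (simp only: I_tilde_def f_def l_def emb_0 mult_zero_right)
qed

end
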